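(* Let $D$ be a knot diagram, and assume that every ineffective region set for $D$ has even cardinality. Call a crossing $c$ of $D$ a $(\star)$-crossing if the crossing change at $c$ is realized by region crossing changes about some set consisting of an odd number of regions of $D$. Then the crossing change at every crossing of $D$ is realized by some finite sequence of region freeze crossing changes on $D$ if and only if the number of $(\star)$-crossings of $D$ is even.
   Context: A knot diagram is a regular projection of a knot into the plane with over/under information at each crossing. Regions are the connected components of the complement of the projection; a crossing touches a region $R$ if it lies on the boundary of $R$. A region crossing change at $R$ changes every crossing touching $R$ (each once); a region freeze crossing change at $R$ changes every crossing not touching $R$ and leaves those touching $R$ unchanged. For a set $\mathcal{R}$ of distinct regions, region crossing changes about $\mathcal{R}$ means applying the region crossing change at each region of $\mathcal{R}$ once (so a crossing is changed iff it touches an odd number of regions of $\mathcal{R}$). A set $\mathcal{R}^{\ast}$ of regions is ineffective for $D$ if region crossing changes about $\mathcal{R}^{\ast}$ do not change $D$ in consequence. A sequence of local moves realizes the crossing change at a crossing $c$ if it produces the same diagram as changing the single crossing $c$ of $D$. *)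

theory Defs
  imports Main
begin

text \<open>Combinatorial model of a knot diagram (a regular knot projection on the
plane / 2-sphere with at least one crossing, together with over/under information).
Crossings form a finite nonempty set C.  Each crossing c has four half-edges (darts)
(c,0),(c,1),(c,2),(c,3) in counterclockwise cyclic order; (c,i) and (c,i+2) are opposite,
i.e. the two strands through c are {0,2} and {1,3}.  The involution alpha glues darts
into edges of the 4-valent projection graph.  Regions are the faces of this
combinatorial map, i.e. the orbits of rot o alpha.\<close>

definition darts :: "'c set \<Rightarrow> ('c \<times> nat) set" where
  "darts C = C \<times> {..<4}"

definition rot :: "'c \<times> nat \<Rightarrow> 'c \<times> nat" where
  "rot d = (fst d, (snd d + 1) mod 4)"

definition orbit :: "('a \<Rightarrow> 'a) \<Rightarrow> 'a \<Rightarrow> 'a set" where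
  "orbit f d = {(f ^^ k) d | k. True}"

text \<open>Regions (faces) of the projection.\<close>
definition regions :: "'c set \<Rightarrow> ('c \<times> nat \<Rightarrow> 'c \<times> nat) \<Rightarrow> ('c \<times> nat) set set" where
  "regions C alpha = {orbit (rot \<circ> alpha) d | d. d \<in> darts C}"

text \<open>Straight-ahead traversal of the curve: go through the crossing, then along the edge.\<close>
definition strands :: "'c set \<Rightarrow> ('c \<times> nat \<Rightarrow> 'c \<times> nat) \<Rightarrow> ('c \<times> nat) set set" where
  "strands C alpha = {orbit (alpha \<circ> rot \<circ> rot) d | d. d \<in> darts C}"

definition connected_map :: "'c set \<Rightarrow> ('c \<times> nat \<Rightarrow> 'c \<times> nat) \<Rightarrow> bool" where
  "connected_map C alpha \<longleftrightarrow>
     (\<forall>d\<in>darts C. \<forall>d'\<in>darts C. (d, d') \<in> ({(x, alpha x) | x. True} \<union> {(x, rot x) | x. True})\<^sup>*)"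

text \<open>A knot projection: alpha is a fixed-point-free involution of the darts, the map is
connected, it is planar (Euler: V - E + F = 2 with V = n, E = 2n, so F = n + 2), and the
curve has exactly one component (the straight-ahead traversal has exactly two orbits,
one for each direction of traversal).\<close>
definition knot_projection :: "'c set \<Rightarrow> ('c \<times> nat \<Rightarrow> 'c \<times> nat) \<Rightarrow> bool" where
  "knot_projection C alpha \<longleftrightarrow>
     finite C \<and> C \<noteq> {} \<and>
     (\<forall>d\<in>darts C. alpha d \<in> darts C \<and> alpha d \<noteq> d \<and> alpha (alpha d) = d) \<and>
     connected_map C alpha \<and>
     card (regions C alpha) = card C + 2 \<and>
     card (strands C alpha) = 2"

text \<open>A knot diagram is a projection (C, alpha) together with over/under information
ov :: 'c \<Rightarrow> bool (ov c = True: the strand {0,2} passes over at c).  All operations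
below keep the projection fixed and only modify ov, so two diagrams on the same
projection coincide iff their ov functions coincide (ov is only relevant on C, and the
operations never modify it outside C).\<close>

definition touches :: "'c \<Rightarrow> ('c \<times> nat) set \<Rightarrow> bool" where
  "touches c R \<longleftrightarrow> (\<exists>i<4. (c, i) \<in> R)"

definition crossing_change :: "'c \<Rightarrow> ('c \<Rightarrow> bool) \<Rightarrow> ('c \<Rightarrow> bool)" where
  "crossing_change c ov = ov(c := \<not> ov c)"

text \<open>Region crossing changes about a set S of regions: crossing c changes iff it touches
an odd number of regions of S.\<close>
definition rcc_about :: "'c set \<Rightarrow> ('c \<times> nat) set set \<Rightarrow> ('c \<Rightarrow> bool) \<Rightarrow> ('c \<Rightarrow> bool)" where
  "rcc_about C S ov = (\<lambda>c. if c \<in> C \<and> odd (card {R \<in> S. touches c R}) then \<not> ov c else ov c)"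

text \<open>Region freeze crossing change at R: changes every crossing not touching R.\<close>
definition freeze_cc :: "'c set \<Rightarrow> ('c \<times> nat) set \<Rightarrow> ('c \<Rightarrow> bool) \<Rightarrow> ('c \<Rightarrow> bool)" where
  "freeze_cc C R ov = (\<lambda>c. if c \<in> C \<and> \<not> touches c R then \<not> ov c else ov c)"

definition ineffective :: "'c set \<Rightarrow> ('c \<times> nat \<Rightarrow> 'c \<times> nat) \<Rightarrow> ('c \<Rightarrow> bool) \<Rightarrow> ('c \<times> nat) set set \<Rightarrow> bool" where
  "ineffective C alpha ov S \<longleftrightarrow> S \<subseteq> regions C alpha \<and> rcc_about C S ov = ov"

definition star_crossing :: "'c set \<Rightarrow> ('c \<times> nat \<Rightarrow> 'c \<times> nat) \<Rightarrow> ('c \<Rightarrow> bool) \<Rightarrow> 'c \<Rightarrow> bool" where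
  "star_crossing C alpha ov c \<longleftrightarrow>
     (\<exists>S. S \<subseteq> regions C alpha \<and> odd (card S) \<and> rcc_about C S ov = crossing_change c ov)"

text \<open>A finite sequence of region freeze crossing changes (applied left to right)
realizes the crossing change at c.\<close>
definition freeze_realizable :: "'c set \<Rightarrow> ('c \<times> nat \<Rightarrow> 'c \<times> nat) \<Rightarrow> ('c \<Rightarrow> bool) \<Rightarrow> 'c \<Rightarrow> bool" where
  "freeze_realizable C alpha ov c \<longleftrightarrow>
     (\<exists>rs. set rs \<subseteq> regions C alpha \<and> fold (freeze_cc C) rs ov = crossing_change c ov)"

end

theory Submission
  imports Defs
begin

text \<open>
  Work modulo 2. The essential input is that region crossing changes realize every set of
  crossings. First count corners with multiplicity: if the indicator function of a set of regions
  has even corner sum at every crossing, then its jump across edges is constant along the knot, so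
  the kernel of the corner matrix has at most four elements, and since there are
  \<open>card C + 2\<close> regions, that matrix is surjective. It differs from the touching matrix exactly at
  nugatory crossings, where one region \<open>a\<close> has two opposite corners. A closed curve in \<open>a\<close>
  through such a crossing \<open>c\<close> separates the remaining regions into two sides. The regions on one
  side of the checkerboard colour different from \<open>a\<close> have odd corner sum at \<open>c\<close> only; apart
  from \<open>c\<close>, the crossings that touch an odd number of them are nugatory with strictly smaller
  sides. Induction on the size of the side gives surjectivity of the touching matrix.

  By the hypothesis on ineffective sets, the parity of \<open>card S\<close> is a linear functional \<open>p\<close> of the
  set of crossings changed by \<open>S\<close>, and \<open>p\<close> is 1 on \<open>{c}\<close> iff \<open>c\<close> is a star crossing. Freeze crossing
  changes realize the sets \<open>v + p(v) C\<close>, and \<open>v \<mapsto> v + p(v) C\<close> is bijective iff \<open>p(C) = 0\<close>.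
\<close>

section \<open>Parity of cardinalities, fibre counting and cyclic orbits\<close>

lemma odd_card_sym_diff:
  assumes "finite A" "finite B"
  shows "odd (card (sym_diff A B)) \<longleftrightarrow> odd (card A) \<noteq> odd (card B)"
proof -
  have "card (sym_diff A B) = card (A - B) + card (B - A)"
    using assms by (intro card_Un_disjoint) auto
  moreover have "card A = card (A - B) + card (A \<inter> B)"
    using assms by (metis add.commute card_Int_Diff)
  moreover have "card B = card (B - A) + card (A \<inter> B)"
    using assms by (metis add.commute card_Int_Diff inf_commute)
  ultimately show ?thesis by auto
qed

lemma card_le_fibres:
  assumes "finite A" "\<And>y. y \<in> f ` A \<Longrightarrow> card {x \<in> A. f x = y} \<le> k"
  shows "card A \<le> k * card (f ` A)"
proof -
  have "A = (\<Union>y\<in>f ` A. {x \<in> A. f x = y})" by auto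
  then have "card A \<le> (\<Sum>y\<in>f ` A. card {x \<in> A. f x = y})"
    using card_UN_le[of "f ` A" "\<lambda>y. {x \<in> A. f x = y}"] assms(1) by simp
  also have "\<dots> \<le> (\<Sum>y\<in>f ` A. k)" using assms(2) by (intro sum_mono)
  finally show ?thesis by (simp add: mult.commute)
qed

lemma funpow_closed:
  assumes "\<And>x. x \<in> A \<Longrightarrow> f x \<in> A" "x \<in> A"
  shows "(f ^^ k) x \<in> A"
  using assms by (induction k) auto

lemma finite_inj_on_cycle:
  assumes "finite A" "\<And>x. x \<in> A \<Longrightarrow> f x \<in> A" "inj_on f A" "x \<in> A"
  shows "\<exists>m>0. (f ^^ m) x = x"
proof -
  have "\<not> inj (\<lambda>k. (f ^^ k) x)"
  proof
    assume inj: "inj (\<lambda>k. (f ^^ k) x)"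
    have "range (\<lambda>k. (f ^^ k) x) \<subseteq> A"
      using funpow_closed[of A f x] assms by auto
    then have "finite (UNIV :: nat set)"
      using finite_imageD[OF finite_subset[OF _ assms(1)] inj] by simp
    then show False by simp
  qed
  then obtain i j where ij: "i < j" "(f ^^ i) x = (f ^^ j) x"
    unfolding inj_on_def by (metis linorder_neqE_nat)
  have "(f ^^ i) x = (f ^^ (i + d)) x \<Longrightarrow> x = (f ^^ d) x" for d
  proof (induction i)
    case (Suc i)
    then show ?case
      using inj_onD[OF assms(3), of "(f ^^ i) x" "(f ^^ (i + d)) x"]
        funpow_closed[of A f x] assms(2,4) by simp
  qed simp
  from this[of "j - i"] ij show ?thesis by (intro exI[of _ "j - i"]) auto
qed

lemma orbit_self: "x \<in> orbit f x"
  unfolding orbit_def by (auto intro: exI[of _ 0])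

lemma orbit_trans: "y \<in> orbit f x \<Longrightarrow> z \<in> orbit f y \<Longrightarrow> z \<in> orbit f x"
  unfolding orbit_def by clarsimp (metis comp_apply funpow_add)

text \<open>\<open>orbit\<close> only follows forward iterates; on a finite set an injective
  self-map runs in cycles, so going on forward leads from \<open>y\<close> back to
  \<open>x\<close>.\<close>

lemma orbit_eq:
  assumes "finite A" "\<And>x. x \<in> A \<Longrightarrow> f x \<in> A" "inj_on f A" "x \<in> A" "y \<in> orbit f x"
  shows "orbit f y = orbit f x"
proof -
  obtain k where k: "y = (f ^^ k) x" using assms(5) by (auto simp: orbit_def)
  obtain m where m: "m > 0" "(f ^^ m) x = x" using finite_inj_on_cycle[OF assms(1-4)] by blast
  have "(f ^^ (m * l)) x = x" for l
    by (induction l) (auto simp: funpow_add m)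
  moreover have "m * k = (m * k - k) + k" using m(1) by (cases m) auto
  ultimately have "(f ^^ (m * k - k)) y = x" unfolding k by (metis comp_apply funpow_add)
  then have "x \<in> orbit f y" by (auto simp: orbit_def)
  then have "z \<in> orbit f x \<Longrightarrow> z \<in> orbit f y" for z by (rule orbit_trans)
  moreover have "z \<in> orbit f y \<Longrightarrow> z \<in> orbit f x" for z using assms(5) by (rule orbit_trans)
  ultimately show ?thesis by (intro set_eqI iffI)
qed

section \<open>The four darts at a crossing\<close>

lemma rot_darts: "x \<in> darts C \<Longrightarrow> rot x \<in> darts C"
  by (auto simp: darts_def rot_def)

lemma fst_rot [simp]: "fst (rot x) = fst x"
  by (simp add: rot_def)

lemma darts_cases:
  assumes "x \<in> darts C"
  obtains c where "c \<in> C" "x \<in> {(c, 0), (c, 1), (c, 2), (c, 3)}"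
proof -
  obtain c i where "x = (c, i)" "c \<in> C" "i < 4" using assms by (auto simp: darts_def)
  moreover from this have "i \<in> {0, 1, 2, 3}" by auto
  ultimately show ?thesis using that by auto
qed

lemma rot4: "x \<in> darts C \<Longrightarrow> rot (rot (rot (rot x))) = x"
  by (erule darts_cases) (auto simp: rot_def)

lemma rot_rot_neq: "x \<in> darts C \<Longrightarrow> rot (rot x) \<noteq> x"
  by (erule darts_cases) (auto simp: rot_def mod_Suc)

lemma same_crossing_cases:
  assumes "x \<in> darts C" "y \<in> darts C" "fst y = fst x"
  shows "y \<in> {x, rot x, rot (rot x), rot (rot (rot x))}"
proof -
  obtain c i j where x: "x = (c, i)" "i < 4" and y: "y = (c, j)" "j < 4"
    using assms by (auto simp: darts_def)
  have "j = i \<or> j = (i + 1) mod 4 \<or> j = (i + 2) mod 4 \<or> j = (i + 3) mod 4"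
  proof -
    have "i = 0 \<or> i = 1 \<or> i = 2 \<or> i = 3" "j = 0 \<or> j = 1 \<or> j = 2 \<or> j = 3"
      using x(2) y(2) by linarith+
    then show ?thesis by (elim disjE; simp)
  qed
  then show ?thesis unfolding x y rot_def by (simp add: mod_simps add.commute)
qed

lemma rot_inj: "x \<in> darts C \<Longrightarrow> y \<in> darts C \<Longrightarrow> rot x = rot y \<Longrightarrow> x = y"
  by (metis rot4)

section \<open>Regions and connectedness of the dual graph\<close>

locale knot_map =
  fixes C :: "'c set" and alpha :: "'c \<times> nat \<Rightarrow> 'c \<times> nat"
  assumes proj: "knot_projection C alpha"
begin

abbreviation D :: "('c \<times> nat) set" where "D \<equiv> darts C"

definition face :: "'c \<times> nat \<Rightarrow> ('c \<times> nat) set" where "face = orbit (rot \<circ> alpha)"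

abbreviation faces :: "('c \<times> nat) set set" where "faces \<equiv> regions C alpha"

lemma finC: "finite C" and neC: "C \<noteq> {}"
  and alpha_D: "x \<in> D \<Longrightarrow> alpha x \<in> D"
  and alpha_neq: "x \<in> D \<Longrightarrow> alpha x \<noteq> x"
  and alpha2: "x \<in> D \<Longrightarrow> alpha (alpha x) = x"
  and conn: "connected_map C alpha"
  and card_faces: "card faces = card C + 2"
  and card_strands: "card (strands C alpha) = 2"
  using proj unfolding knot_projection_def by auto

lemmas rot_D = rot_darts[of _ C]

lemma finD: "finite D" using finC by (simp add: darts_def)

lemma fin_faces: "finite faces"
proof -
  have "faces = face ` D" by (auto simp: regions_def face_def)
  then show ?thesis using finD by simp
qed

lemma face_step_inj: "inj_on (rot \<circ> alpha) D"
  by (rule inj_onI) (metis alpha2 alpha_D comp_apply rot_inj)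

lemma face_eq: "x \<in> D \<Longrightarrow> y \<in> face x \<Longrightarrow> face y = face x"
  unfolding face_def
  by (rule orbit_eq[OF finD _ face_step_inj]) (auto simp: alpha_D rot_D)

lemma face_in: "x \<in> D \<Longrightarrow> face x \<in> faces"
  unfolding regions_def face_def by blast

lemma faces_cases: "R \<in> faces \<Longrightarrow> (\<And>x. x \<in> D \<Longrightarrow> R = face x \<Longrightarrow> thesis) \<Longrightarrow> thesis"
  unfolding regions_def face_def by blast

lemma face_self: "x \<in> face x"
  by (simp add: face_def orbit_self)

lemma face_mem_iff: "R \<in> faces \<Longrightarrow> x \<in> D \<Longrightarrow> x \<in> R \<longleftrightarrow> face x = R"
  by (metis face_eq faces_cases face_self)

text \<open>The face permutation sends \<open>alpha x\<close> to \<open>rot x\<close>; thus the edge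
  of \<open>x\<close> has \<open>face x\<close> and \<open>face (rot x)\<close> on its two
  sides.\<close>

lemma face_rot: "x \<in> D \<Longrightarrow> face (rot x) = face (alpha x)"
proof -
  assume x: "x \<in> D"
  have "rot x = ((rot \<circ> alpha) ^^ 1) (alpha x)" using x by (simp add: alpha2)
  then have "rot x \<in> face (alpha x)" unfolding face_def orbit_def by blast
  then show ?thesis using face_eq alpha_D x by blast
qed

text \<open>By \<open>face_rot\<close>, turning by \<open>rot\<close> at a crossing amounts to
  crossing an edge, so connectedness on darts becomes connectedness of the dual graph.\<close>

lemma const_of_face_inv:
  assumes "\<And>x. x \<in> D \<Longrightarrow> P (face x) \<longleftrightarrow> P (face (alpha x))" "R \<in> faces" "R' \<in> faces"
  shows "P R \<longleftrightarrow> P R'"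
proof -
  obtain x y where xy: "x \<in> D" "R = face x" "y \<in> D" "R' = face y"
    using assms(2,3) by (metis faces_cases)
  have "(x, y) \<in> ({(x, alpha x) | x. True} \<union> {(x, rot x) | x. True})\<^sup>*"
    using conn xy by (auto simp: connected_map_def)
  then have "y \<in> D \<and> (P (face x) \<longleftrightarrow> P (face y))"
  proof (induction rule: rtrancl_induct)
    case base
    then show ?case using xy by simp
  next
    case (step y z)
    have y: "y \<in> D" and P: "P (face x) \<longleftrightarrow> P (face y)" using step.IH by auto
    have "z = alpha y \<or> z = rot y" using step.hyps by blast
    then show ?case using P assms(1)[OF y] alpha_D[OF y] rot_D[OF y] face_rot[OF y] by metis
  qed
  then show ?thesis using xy by simp
qed

section \<open>Walking along the knot\<close>

definition step :: "'c \<times> nat \<Rightarrow> 'c \<times> nat" where "step = alpha \<circ> rot \<circ> rot"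

lemma step_apply: "step x = alpha (rot (rot x))"
  by (simp add: step_def)

lemma step_D: "x \<in> D \<Longrightarrow> step x \<in> D"
  by (simp add: step_def alpha_D rot_D)

lemma step_inj: "inj_on step D"
  by (rule inj_onI) (metis alpha2 comp_apply rot_D rot_inj step_def)

text \<open>Travelling along the knot never leads to the same edge in the opposite direction:
  the middle of such a walk would be a fixed point of the edge involution or of the half turn.\<close>
lemma step_no_reversal: "x \<in> D \<Longrightarrow> (step ^^ k) x \<noteq> rot (rot x)"
proof (induction k arbitrary: x rule: induct_nat_012)
  case 0
  then show ?case using rot_rot_neq[of x C] by simp
next
  case 1
  then show ?case using alpha_neq[of "rot (rot x)"] rot_D by (simp add: step_def)
next
  case (ge2 k)
  show ?case
  proof
    assume eq: "(step ^^ Suc (Suc k)) x = rot (rot x)"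
    have "(step ^^ k) (step x) \<in> D" using funpow_closed[of D step] ge2.prems step_D by blast
    moreover have "step ((step ^^ k) (step x)) = rot (rot x)"
      using eq by (simp add: funpow_swap1)
    \<comment> \<open>The half turn conjugates \<open>step\<close> to its inverse; hence the walk
      can be shortened at both ends, lowering its length by two.\<close>
    moreover have "step (rot (rot (step x))) = rot (rot x)"
      using ge2.prems by (simp add: step_def rot4[of _ C] alpha_D alpha2 rot_D)
    ultimately have "(step ^^ k) (step x) = rot (rot (step x))"
      using step_inj step_D ge2.prems rot_D by (metis inj_onD)
    then show False using ge2.IH step_D ge2.prems by blast
  qed
qed

text \<open>This is where having one component enters: the strands of \<open>x\<close> and of its
  half turn are distinct by \<open>step_no_reversal\<close>, so they are all the strands, and
  \<open>g\<close> agrees on both.\<close>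

lemma const_of_strand_inv:
  assumes "\<And>x. x \<in> D \<Longrightarrow> g (alpha x) \<longleftrightarrow> g x" "\<And>x. x \<in> D \<Longrightarrow> g (rot (rot x)) \<longleftrightarrow> g x"
    and "x \<in> D" "y \<in> D"
  shows "g x \<longleftrightarrow> g y"
proof -
  have inv: "g z \<longleftrightarrow> g u" if u: "u \<in> D" and z: "z \<in> orbit step u" for u z
  proof -
    have "g ((step ^^ k) u) \<longleftrightarrow> g u" for k
    proof (induction k)
      case (Suc k)
      have "(step ^^ k) u \<in> D" using funpow_closed[of D step u k] step_D u by blast
      then have "g (step ((step ^^ k) u)) \<longleftrightarrow> g ((step ^^ k) u)"
        unfolding step_apply using assms(1,2) rot_D by metis
      then show ?case using Suc by simp
    qed simp
    then show ?thesis using z by (auto simp: orbit_def)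
  qed
  have str: "strands C alpha = orbit step ` D" by (auto simp: strands_def step_def comp_assoc)
  let ?O = "orbit step x" and ?O' = "orbit step (rot (rot x))"
  have "rot (rot x) \<notin> ?O" using step_no_reversal[OF assms(3)] by (force simp: orbit_def)
  then have "?O \<noteq> ?O'" using orbit_self[of "rot (rot x)" step] by metis
  moreover have "{?O, ?O'} \<subseteq> strands C alpha" using str assms(3) rot_D by auto
  moreover have "finite (strands C alpha)" using str finD by simp
  ultimately have "strands C alpha = {?O, ?O'}"
    using card_strands by (metis card_2_iff card_subset_eq)
  then have "orbit step y = ?O \<or> orbit step y = ?O'" using str assms(4) by blast
  then have "y \<in> ?O \<or> y \<in> ?O'" using orbit_self[of y step] by auto
  then show ?thesis using inv assms(2,3) rot_D by metis
qed

section \<open>Corner sums modulo 2 and the checkerboard colouring\<close>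

text \<open>In contrast to \<^const>\<open>rcc_about\<close>, a region with two corners at the crossing counts twice.\<close>
definition corner_parity :: "('c \<times> nat) set set \<Rightarrow> 'c \<times> nat \<Rightarrow> bool" where
  "corner_parity S x \<longleftrightarrow> ((face x \<in> S) \<noteq> (face (rot x) \<in> S)) \<noteq>
     ((face (rot (rot x)) \<in> S) \<noteq> (face (rot (rot (rot x))) \<in> S))"

definition odd_corners :: "('c \<times> nat) set set \<Rightarrow> 'c set" where
  "odd_corners S = {c \<in> C. corner_parity S (c, 0)}"

definition separates :: "('c \<times> nat) set set \<Rightarrow> 'c \<times> nat \<Rightarrow> bool" where
  "separates S x \<longleftrightarrow> (face x \<in> S) \<noteq> (face (alpha x) \<in> S)"

lemma base_dart: "c \<in> C \<Longrightarrow> (c, 0) \<in> D" by (simp add: darts_def)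

lemma fst_D: "x \<in> D \<Longrightarrow> fst x \<in> C" by (auto simp: darts_def)

lemma corner_parity_rot: "x \<in> D \<Longrightarrow> corner_parity S (rot x) \<longleftrightarrow> corner_parity S x"
  unfolding corner_parity_def by (auto simp: rot4[of x C])

lemma rot_invariant:
  assumes "\<And>y. y \<in> D \<Longrightarrow> P (rot y) \<longleftrightarrow> P y" "x \<in> D"
  shows "P x \<longleftrightarrow> P (fst x, 0)"
proof -
  have y: "(fst x, 0) \<in> D" using assms(2) fst_D base_dart by blast
  show ?thesis
    using same_crossing_cases[OF y assms(2)] assms(1)[OF y] assms(1)[OF rot_D[OF y]]
      assms(1)[OF rot_D[OF rot_D[OF y]]] by auto
qed

lemma corner_parity_iff: "x \<in> D \<Longrightarrow> corner_parity S x \<longleftrightarrow> fst x \<in> odd_corners S"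
proof -
  assume x: "x \<in> D"
  have "corner_parity S x \<longleftrightarrow> corner_parity S (fst x, 0)" using corner_parity_rot x by (rule rot_invariant)
  then show ?thesis using x fst_D by (auto simp: odd_corners_def)
qed

lemma odd_corners_subset: "odd_corners S \<subseteq> C" by (auto simp: odd_corners_def)

lemma odd_corners_sym_diff: "odd_corners (sym_diff S T) = sym_diff (odd_corners S) (odd_corners T)"
  unfolding odd_corners_def corner_parity_def by auto

lemma separates_alpha: "x \<in> D \<Longrightarrow> separates S (alpha x) \<longleftrightarrow> separates S x"
  by (auto simp: separates_def alpha2)

lemma separates_rot: "x \<in> D \<Longrightarrow> separates S x \<longleftrightarrow> (face x \<in> S) \<noteq> (face (rot x) \<in> S)"
  by (simp add: separates_def face_rot)

text \<open>Opposite edges at a crossing flank all four corners between them, so their two jumps add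
  up to the corner sum.\<close>

lemma separates_rot_rot: "x \<in> D \<Longrightarrow> separates S (rot (rot x)) \<longleftrightarrow> (separates S x \<noteq> corner_parity S x)"
  unfolding corner_parity_def using separates_rot[of x S] separates_rot[of "rot (rot x)" S] rot_D by blast

lemma separates_sym_diff: "separates (sym_diff S T) x \<longleftrightarrow> separates S x \<noteq> separates T x"
  by (auto simp: separates_def)

lemma separates_none:
  assumes "S \<subseteq> faces" "\<And>x. x \<in> D \<Longrightarrow> \<not> separates S x"
  shows "S = {} \<or> S = faces"
proof -
  have "R \<in> S \<longleftrightarrow> R' \<in> S" if "R \<in> faces" "R' \<in> faces" for R R'
    using _ that by (rule const_of_face_inv) (use assms(2) separates_def in blast)
  then show ?thesis using assms(1) by auto
qed

lemma separates_const_of_kernel: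
  assumes "odd_corners S = {}" "x \<in> D" "y \<in> D"
  shows "separates S x \<longleftrightarrow> separates S y"
proof (rule const_of_strand_inv[OF _ _ assms(2,3)])
  fix x assume "x \<in> D"
  then show "separates S (alpha x) \<longleftrightarrow> separates S x" "separates S (rot (rot x)) \<longleftrightarrow> separates S x"
    using separates_alpha separates_rot_rot corner_parity_iff assms(1) by blast+
qed

text \<open>Each fibre is a coset of the kernel: \<open>sym_diff S\<close> moves it injectively into
  the kernel.\<close>

lemma card_le_kernel_image:
  assumes K: "card {S \<in> Pow faces. odd_corners S = {}} \<le> k"
  shows "2 ^ card faces \<le> k * card (odd_corners ` Pow faces)"
proof -
  have fin: "finite {S \<in> Pow faces. odd_corners S = {}}" using fin_faces by simp
  have "card (Pow faces) \<le> k * card (odd_corners ` Pow faces)"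
  proof (rule card_le_fibres)
    fix Y assume "Y \<in> odd_corners ` Pow faces"
    then obtain S where S: "S \<in> Pow faces" "odd_corners S = Y" by blast
    have "inj_on (sym_diff S) {T \<in> Pow faces. odd_corners T = Y}" by (rule inj_onI) blast
    moreover have "sym_diff S ` {T \<in> Pow faces. odd_corners T = Y} \<subseteq> {S \<in> Pow faces. odd_corners S = {}}"
      using S by (auto simp: odd_corners_sym_diff)
    ultimately have "card {T \<in> Pow faces. odd_corners T = Y} \<le> card {S \<in> Pow faces. odd_corners S = {}}"
      using fin by (rule card_inj_on_le)
    then show "card {T \<in> Pow faces. odd_corners T = Y} \<le> k" using K by simp
  qed (use fin_faces in simp)
  then show ?thesis using fin_faces by (simp add: card_Pow)
qed

lemma card_image_odd_corners: "card (odd_corners ` Pow faces) \<le> 2 ^ card C"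
proof -
  have "card (odd_corners ` Pow faces) \<le> card (Pow C)" using odd_corners_subset finC by (intro card_mono) auto
  then show ?thesis using finC by (simp add: card_Pow)
qed

lemma ker_dichotomy:
  assumes "odd_corners S = {}"
  shows "(\<forall>x\<in>D. separates S x) \<or> (\<forall>x\<in>D. \<not> separates S x)"
  by (metis separates_const_of_kernel[OF assms])

text \<open>Otherwise the kernel would have at most two elements, giving the corner map rank at
  least \<open>card C + 1\<close>, which is too large for subsets of \<open>C\<close>.\<close>

lemma checkerboard_exists: "\<exists>S\<subseteq>faces. \<forall>x\<in>D. separates S x"
proof (rule ccontr)
  assume no: "\<not> ?thesis"
  have "{S \<in> Pow faces. odd_corners S = {}} \<subseteq> {{}, faces}"
  proof
    fix S assume "S \<in> {S \<in> Pow faces. odd_corners S = {}}"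
    then have S: "S \<subseteq> faces" "odd_corners S = {}" by auto
    have "\<forall>x\<in>D. \<not> separates S x" using ker_dichotomy[OF S(2)] no S(1) by metis
    then show "S \<in> {{}, faces}" using separates_none[OF S(1)] by simp
  qed
  then have "card {S \<in> Pow faces. odd_corners S = {}} \<le> card {{}, faces}" by (intro card_mono) auto
  also have "\<dots> \<le> 2" by (simp add: card_insert_if)
  finally have "2 ^ card faces \<le> 2 * card (odd_corners ` Pow faces)" by (rule card_le_kernel_image)
  also have "\<dots> \<le> 2 * 2 ^ card C" using card_image_odd_corners by simp
  finally show False by (simp add: card_faces)
qed

lemma odd_corners_surj:
  assumes "Y \<subseteq> C"
  shows "\<exists>S\<subseteq>faces. odd_corners S = Y"
proof -
  obtain T where T: "T \<subseteq> faces" "\<forall>x\<in>D. separates T x" using checkerboard_exists by blast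
  have "{S \<in> Pow faces. odd_corners S = {}} \<subseteq> {{}, faces, T, faces - T}"
  proof
    fix S assume "S \<in> {S \<in> Pow faces. odd_corners S = {}}"
    then have S: "S \<subseteq> faces" "odd_corners S = {}" by auto
    show "S \<in> {{}, faces, T, faces - T}"
    proof (cases "\<forall>x\<in>D. separates S x")
      case True
      then have "\<And>x. x \<in> D \<Longrightarrow> \<not> separates (sym_diff S T) x" using T separates_sym_diff by metis
      moreover have "sym_diff S T \<subseteq> faces" using S T by blast
      ultimately have "sym_diff S T = {} \<or> sym_diff S T = faces" using separates_none by metis
      then show ?thesis using S T by auto
    next
      case False
      then have "\<forall>x\<in>D. \<not> separates S x" using ker_dichotomy[OF S(2)] by blast
      then show ?thesis using separates_none[OF S(1)] by blast
    qed
  qed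
  then have "card {S \<in> Pow faces. odd_corners S = {}} \<le> card {{}, faces, T, faces - T}"
    by (intro card_mono) auto
  also have "\<dots> \<le> 4" using card_length[of "[{}, faces, T, faces - T]"] by simp
  finally have "2 ^ card faces \<le> 4 * card (odd_corners ` Pow faces)" by (rule card_le_kernel_image)
  then have "card (Pow C) \<le> card (odd_corners ` Pow faces)" using finC by (simp add: card_Pow card_faces)
  then have "odd_corners ` Pow faces = Pow C"
    using odd_corners_subset finC by (intro card_seteq) auto
  then have "Y \<in> odd_corners ` Pow faces" using assms by simp
  then show ?thesis by blast
qed

text \<open>Planarity in homological form: mod 2 cycles of edges bound sets of regions.\<close>
lemma cycle_bounds:
  assumes z_alpha: "\<And>x. x \<in> D \<Longrightarrow> z (alpha x) \<longleftrightarrow> z x"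
    and even: "\<And>x. x \<in> D \<Longrightarrow> (z x \<noteq> z (rot x)) \<longleftrightarrow> (z (rot (rot x)) \<noteq> z (rot (rot (rot x))))"
  shows "\<exists>S\<subseteq>faces. \<forall>x\<in>D. separates S x \<longleftrightarrow> z x"
proof -
  \<comment> \<open>By \<open>separates_rot_rot\<close>, these corner sums are forced on any set
    with boundary \<open>z\<close>.\<close>
  obtain S where S: "S \<subseteq> faces" "odd_corners S = {c \<in> C. z (c, 0) \<noteq> z (rot (rot (c, 0)))}"
    using odd_corners_surj[of "{c \<in> C. z (c, 0) \<noteq> z (rot (rot (c, 0)))}"] by auto
  have w: "corner_parity S x \<longleftrightarrow> z x \<noteq> z (rot (rot x))" if x: "x \<in> D" for x
  proof -
    have "(z x \<noteq> z (rot (rot x))) \<longleftrightarrow> (z (fst x, 0) \<noteq> z (rot (rot (fst x, 0))))"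
    proof (rule rot_invariant[OF _ x])
      fix y assume y: "y \<in> D"
      show "(z (rot y) \<noteq> z (rot (rot (rot y)))) \<longleftrightarrow> (z y \<noteq> z (rot (rot y)))"
        using even[OF y] by blast
    qed
    then show ?thesis using corner_parity_iff[OF x] S x fst_D by auto
  qed
  obtain T where T: "T \<subseteq> faces" "\<forall>x\<in>D. separates T x" using checkerboard_exists by blast
  \<comment> \<open>The error is constant along the knot; if it is 1 everywhere, adding the
    checkerboard class \<open>T\<close> removes it.\<close>
  let ?g = "\<lambda>x. z x \<noteq> separates S x"
  have const: "?g x \<longleftrightarrow> ?g y" if "x \<in> D" "y \<in> D" for x y
  proof (rule const_of_strand_inv[OF _ _ that])
    fix x assume x: "x \<in> D"
    show "?g (alpha x) \<longleftrightarrow> ?g x" using z_alpha[OF x] separates_alpha[OF x] by simp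
    show "?g (rot (rot x)) \<longleftrightarrow> ?g x" using separates_rot_rot[OF x] w[OF x] by blast
  qed
  show ?thesis
  proof (cases "\<exists>x\<in>D. ?g x")
    case True
    then have "\<forall>x\<in>D. separates (sym_diff S T) x \<longleftrightarrow> z x" using const T separates_sym_diff by metis
    moreover have "sym_diff S T \<subseteq> faces" using S T by blast
    ultimately show ?thesis by blast
  next
    case False
    then show ?thesis using S by blast
  qed
qed

section \<open>Nugatory crossings and their sides\<close>

lemma separates_compl: "x \<in> D \<Longrightarrow> separates (faces - S) x \<longleftrightarrow> separates S x"
  using face_in alpha_D by (auto simp: separates_def)

text \<open>\<open>K\<close> consists of the regions on one side of a closed curve inside the region \<open>a\<close>
  passing once through the nugatory crossing \<open>c\<close>, the side not containing \<open>R0\<close>.\<close>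
definition side :: "('c \<times> nat) set \<Rightarrow> 'c \<Rightarrow> ('c \<times> nat) set \<Rightarrow> ('c \<times> nat) set set \<Rightarrow> bool" where
  "side R0 c a K \<longleftrightarrow> K \<subseteq> faces \<and> a \<in> faces \<and> a \<notin> K \<and> R0 \<notin> K \<and>
     (\<forall>y\<in>D. separates K y \<longrightarrow> face y = a \<or> face (alpha y) = a) \<and> (\<exists>T\<subseteq>K. odd_corners T = {c})"

lemma sideI:
  assumes "K \<subseteq> faces" "a \<in> faces" "a \<notin> K" "R0 \<notin> K"
    and "\<And>y. y \<in> D \<Longrightarrow> separates K y \<Longrightarrow> face y = a \<or> face (alpha y) = a"
    and "T \<subseteq> K" "odd_corners T = {c}"
  shows "side R0 c a K"
  unfolding side_def using assms by blast

lemma sideD: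
  assumes "side R0 c a K"
  shows "K \<subseteq> faces" "a \<in> faces" "a \<notin> K" "R0 \<notin> K"
    and "\<And>y. y \<in> D \<Longrightarrow> (face y \<in> K) \<noteq> (face (alpha y) \<in> K) \<Longrightarrow> face y = a \<or> face (alpha y) = a"
    and "\<exists>T\<subseteq>K. odd_corners T = {c}"
  using assms unfolding side_def separates_def by simp_all

text \<open>\<open>W\<close> is the part of the boundary walk of the face of \<open>x\<close> between its two visits to the
  crossing.\<close>
lemma face_walk:
  assumes x: "x \<in> D" and f: "face (rot (rot x)) = face x"
  obtains W where "W \<subseteq> face x" "\<And>y. y \<in> D \<Longrightarrow>
    (alpha y \<in> W) \<longleftrightarrow> ((rot y \<in> W) \<noteq> (rot y = x \<or> rot y = rot (rot x)))"
proof -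
  let ?p = "rot \<circ> alpha" and ?e = "rot (rot x)"
  have p_D: "\<And>y. y \<in> D \<Longrightarrow> ?p y \<in> D" by (simp add: alpha_D rot_D)
  have xk: "(?p ^^ k) x \<in> D" for k using funpow_closed[of D ?p] p_D x by blast
  have xe: "x \<noteq> ?e" using rot_rot_neq[OF x] by simp
  have "?e \<in> face x" using f face_self by metis
  then have ex: "\<exists>k. (?p ^^ k) x = ?e" unfolding face_def orbit_def by force
  \<comment> \<open>The first visit to the opposite corner, so that \<open>W\<close> contains its
    start \<open>x\<close> but not its end \<open>?e\<close>.\<close>
  define m where "m = (LEAST k. (?p ^^ k) x = ?e)"
  have m: "(?p ^^ m) x = ?e" unfolding m_def using ex by (rule LeastI_ex)
  have least: "(?p ^^ k) x \<noteq> ?e" if "k < m" for k using that not_less_Least unfolding m_def by blast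
  have m0: "m > 0" using m xe by (cases m) auto
  define W where "W = (\<lambda>k. (?p ^^ k) x) ` {..<m}"
  have inj: "u = v" if "u \<in> D" "v \<in> D" "?p u = ?p v" for u v
    using face_step_inj that by (meson inj_onD)
  have e_W: "?e \<notin> W" using least unfolding W_def by force
  have x_W: "x \<in> W" using m0 by (force simp: W_def intro: image_eqI[of _ _ 0])
  \<comment> \<open>The face permutation preserves membership in \<open>W\<close> except on entering
    at \<open>x\<close> and leaving at \<open>?e\<close>.\<close>
  have key: "u \<in> W \<longleftrightarrow> ((?p u \<in> W) \<noteq> (?p u = x \<or> ?p u = ?e))" if u: "u \<in> D" for u
  proof -
    consider "?p u = x" | "?p u = ?e" | "?p u \<noteq> x" "?p u \<noteq> ?e" by blast
    then show ?thesis
    proof cases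
      case 1
      have "u \<notin> W"
      proof
        assume "u \<in> W"
        then obtain k where k: "k < m" "u = (?p ^^ k) x" unfolding W_def by blast
        have c: "(?p ^^ Suc k) x = x" using k 1 by simp
        have "(?p ^^ m) x = (?p ^^ (m - Suc k)) ((?p ^^ Suc k) x)"
          using k by (metis Suc_leI comp_apply funpow_add le_add_diff_inverse2)
        then show False using c m least[of "m - Suc k"] k by simp
      qed
      then show ?thesis using 1 x_W by simp
    next
      case 2
      obtain k where k: "m = Suc k" using m0 by (cases m) auto
      have "?p ((?p ^^ k) x) = ?e" using m k by simp
      then have "u = (?p ^^ k) x" using inj[OF u xk] 2 by simp
      then have "u \<in> W" unfolding W_def using k by blast
      then show ?thesis using 2 e_W by simp
    next
      case 3
      have "?p u \<in> W" if uW: "u \<in> W"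
      proof -
        obtain k where k: "k < m" "u = (?p ^^ k) x" using uW unfolding W_def by blast
        then have pu: "?p u = (?p ^^ Suc k) x" by simp
        then have "Suc k \<noteq> m" using 3 m by metis
        then have "Suc k < m" using k by simp
        then show ?thesis unfolding W_def pu by blast
      qed
      moreover have "u \<in> W" if uW: "?p u \<in> W"
      proof -
        obtain k where k: "k < m" "?p u = (?p ^^ k) x" using uW unfolding W_def by blast
        then obtain j where j: "k = Suc j" using 3 by (cases k) auto
        then have "u = (?p ^^ j) x" using inj[OF u xk] k by simp
        moreover have "j < m" using k j by simp
        ultimately show ?thesis unfolding W_def by blast
      qed
      ultimately show ?thesis using 3 by blast
    qed
  qed
  show ?thesis
  proof (rule that)
    show "W \<subseteq> face x" unfolding W_def face_def orbit_def by blast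
    show "(alpha y \<in> W) \<longleftrightarrow> ((rot y \<in> W) \<noteq> (rot y = x \<or> rot y = ?e))" if "y \<in> D" for y
      using key[of "alpha y"] that by (simp add: alpha_D alpha2)
  qed
qed

text \<open>Corner parity does not depend on the dart, so one conveniently chosen dart per crossing
  suffices.\<close>

lemma odd_corners_singleton:
  assumes x: "x \<in> D" and C: "\<And>c. c \<in> C \<Longrightarrow> \<exists>y\<in>D. fst y = c \<and> (corner_parity T y \<longleftrightarrow> c = fst x)"
  shows "odd_corners T = {fst x}"
proof -
  have "c \<in> odd_corners T \<longleftrightarrow> c = fst x" if c: "c \<in> C" for c
  proof -
    obtain y where y: "y \<in> D" "fst y = c" "corner_parity T y \<longleftrightarrow> c = fst x" using C[OF c] by blast
    then show ?thesis using corner_parity_iff[OF y(1)] by simp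
  qed
  then show ?thesis using odd_corners_subset fst_D[OF x] by blast
qed

text \<open>The edges traversed exactly once by the walk \<open>W\<close> lie on
  \<open>face x\<close> and form a mod 2 cycle, which bounds a set of regions. Within the
  checkerboard colour avoiding \<open>face x\<close>, that set has odd corner sum only at the
  crossing where the walk starts and ends.\<close>

lemma side_exists:
  assumes x: "x \<in> D" and f: "face (rot (rot x)) = face x"
  shows "\<exists>K. side R0 (fst x) (face x) K"
proof -
  let ?a = "face x" and ?e = "rot (rot x)"
  obtain W where Wa: "W \<subseteq> ?a" and W: "\<And>y. y \<in> D \<Longrightarrow>
    (alpha y \<in> W) \<longleftrightarrow> ((rot y \<in> W) \<noteq> (rot y = x \<or> rot y = ?e))"
    using face_walk[OF assms] by blast
  define z where "z y \<longleftrightarrow> (y \<in> W) \<noteq> (alpha y \<in> W)" for y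
  \<comment> \<open>\<open>q\<close> corrects for the ends of the walk; being invariant under the
    half turn, it cancels from sums around a crossing.\<close>
  define q where "q y \<longleftrightarrow> rot y = x \<or> rot y = ?e" for y
  have ze: "z y \<longleftrightarrow> ((y \<in> W) \<noteq> (rot y \<in> W)) \<noteq> q y" if "y \<in> D" for y
    unfolding z_def q_def W[OF that] by blast
  have q2: "q (rot (rot y)) \<longleftrightarrow> q y" if y: "y \<in> D" for y
  proof -
    have "rot (rot (rot y)) = x \<longleftrightarrow> rot y = ?e"
      using rot4[OF rot_D[OF y]] rot4[OF x] by metis
    moreover have "rot (rot (rot y)) = ?e \<longleftrightarrow> rot y = x"
      using rot4[OF rot_D[OF y]] rot4[OF x] by metis
    ultimately show ?thesis unfolding q_def by blast
  qed
  have zeven: "(z y \<noteq> z (rot y)) \<longleftrightarrow> (z (rot (rot y)) \<noteq> z (rot (rot (rot y))))" if y: "y \<in> D" for y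
    unfolding ze[OF y] ze[OF rot_D[OF y]] ze[OF rot_D[OF rot_D[OF y]]]
      ze[OF rot_D[OF rot_D[OF rot_D[OF y]]]] rot4[OF y] q2[OF y] q2[OF rot_D[OF y]]
    by auto
  have z_alpha: "z (alpha y) \<longleftrightarrow> z y" if "y \<in> D" for y
    unfolding z_def alpha2[OF that] by blast
  obtain K0 where K0: "K0 \<subseteq> faces" "\<And>y. y \<in> D \<Longrightarrow> separates K0 y \<longleftrightarrow> z y"
    using cycle_bounds[of z, OF z_alpha zeven] by blast
  \<comment> \<open>Complements have the same boundary, so both the bounding set and the
    checkerboard class can be chosen without \<open>?a\<close>.\<close>
  obtain K1 where K1: "K1 \<subseteq> faces" "?a \<notin> K1" "\<And>y. y \<in> D \<Longrightarrow> separates K1 y \<longleftrightarrow> z y"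
  proof (cases "?a \<in> K0")
    case True
    then show ?thesis using that[of "faces - K0"] K0 separates_compl by simp
  next
    case False
    then show ?thesis using that K0 by blast
  qed
  obtain B0 where B0: "B0 \<subseteq> faces" "\<forall>x\<in>D. separates B0 x" using checkerboard_exists by blast
  obtain B where B: "B \<subseteq> faces" "?a \<notin> B" "\<And>x. x \<in> D \<Longrightarrow> separates B x"
  proof (cases "?a \<in> B0")
    case True
    then show ?thesis using that[of "faces - B0"] B0 separates_compl by simp
  next
    case False
    then show ?thesis using that B0 by blast
  qed
  have alt: "face (rot y) \<in> B \<longleftrightarrow> face y \<notin> B" if "y \<in> D" for y
    using B(3)[OF that] separates_rot[OF that] by blast
  have in_a: "face y = ?a" if "y \<in> W" for y using that Wa face_eq x by blast
  \<comment> \<open>Corners of colour \<open>B\<close> are outside \<open>?a\<close>, hence outside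
    \<open>W\<close>, so only \<open>q y\<close> survives in the mod 2 sum of \<open>z y\<close> and
    \<open>z (rot y)\<close>.\<close>
  have K1_B: "(face y \<in> K1) \<noteq> (face (rot (rot y)) \<in> K1) \<longleftrightarrow> fst y = fst x"
    if y: "y \<in> D" "face y \<in> B" for y
  proof -
    have y2: "face (rot (rot y)) \<in> B" using alt y rot_D by blast
    have nW: "y \<notin> W" "rot (rot y) \<notin> W" using in_a B(2) y y2 by metis+
    have ne: "y \<noteq> x" "y \<noteq> ?e" "rot (rot y) \<noteq> x" "rot (rot y) \<noteq> ?e"
      using B(2) y y2 f by metis+
    have "(face y \<in> K1) \<noteq> (face (rot (rot y)) \<in> K1) \<longleftrightarrow> z y \<noteq> z (rot y)"
      using K1(3)[OF y(1)] K1(3)[OF rot_D[OF y(1)]] separates_rot[OF y(1)] separates_rot[OF rot_D[OF y(1)]] by blast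
    also have "\<dots> \<longleftrightarrow> (rot y = x \<or> rot y = ?e)"
      using nW ne unfolding ze[OF y(1)] ze[OF rot_D[OF y(1)]] q_def by blast
    also have "\<dots> \<longleftrightarrow> fst y = fst x"
    proof
      assume "rot y = x \<or> rot y = ?e"
      then show "fst y = fst x" by (metis fst_rot)
    next
      assume "fst y = fst x"
      then have "y \<in> {x, rot x, ?e, rot ?e}" using same_crossing_cases x y by blast
      then show "rot y = x \<or> rot y = ?e" using ne rot4[OF x] by auto
    qed
    finally show ?thesis .
  qed
  \<comment> \<open>Only two opposite corners at each crossing have colour \<open>B\<close>, so the
    corner sum of \<open>K \<inter> B\<close> merely compares these two.\<close>
  have odd_side: "odd_corners (K \<inter> B) = {fst x}"
    if K: "\<And>y. y \<in> D \<Longrightarrow> face y \<in> B \<Longrightarrow>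
      (face y \<in> K) \<noteq> (face (rot (rot y)) \<in> K) \<longleftrightarrow> fst y = fst x" for K
  proof (rule odd_corners_singleton[OF x])
    fix c assume c: "c \<in> C"
    let ?d = "(c, 0)"
    obtain y where y: "y \<in> D" "fst y = c" "face y \<in> B"
      using alt[of ?d] base_dart[OF c] rot_D[of ?d] by (metis fst_conv fst_rot)
    have "corner_parity (K \<inter> B) y \<longleftrightarrow> (face y \<in> K) \<noteq> (face (rot (rot y)) \<in> K)"
      using alt[OF y(1)] alt[OF rot_D[OF y(1)]] alt[OF rot_D[OF rot_D[OF y(1)]]] y
      unfolding corner_parity_def by blast
    then show "\<exists>y\<in>D. fst y = c \<and> (corner_parity (K \<inter> B) y \<longleftrightarrow> c = fst x)" using K y by metis
  qed
  have K1_dl: "face y = ?a \<or> face (alpha y) = ?a" if "y \<in> D" "z y" for y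
    using that in_a unfolding z_def by blast
  show ?thesis
  proof (cases "R0 \<in> K1")
    case False
    have "side R0 (fst x) ?a K1"
    proof (rule sideI[OF K1(1) face_in[OF x] K1(2) False])
      show "face y = ?a \<or> face (alpha y) = ?a" if "y \<in> D" "separates K1 y" for y
        using K1_dl[OF that(1)] K1(3)[OF that(1)] that(2) by blast
      show "odd_corners (K1 \<inter> B) = {fst x}" by (rule odd_side[OF K1_B])
    qed blast
    then show ?thesis by blast
  next
    case True
    \<comment> \<open>The other side of the curve. As \<open>?a\<close> is not in \<open>B\<close>,
      complementing and removing \<open>?a\<close> keeps the comparison of corners in
      \<open>B\<close>.\<close>
    let ?K = "faces - K1 - {?a}"
    have "odd_corners (?K \<inter> B) = {fst x}"
    proof (rule odd_side)
      fix y assume y: "y \<in> D" "face y \<in> B"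
      moreover have "face (rot (rot y)) \<in> B" using alt y rot_D by blast
      ultimately have "face y \<noteq> ?a" "face (rot (rot y)) \<noteq> ?a" using B(2) by metis+
      then show "(face y \<in> ?K) \<noteq> (face (rot (rot y)) \<in> ?K) \<longleftrightarrow> fst y = fst x"
        using K1_B[OF y] face_in[OF y(1)] face_in[OF rot_D[OF rot_D[OF y(1)]]] by simp
    qed
    moreover have "face y = ?a \<or> face (alpha y) = ?a" if y: "y \<in> D" "separates ?K y" for y
    proof (rule ccontr)
      assume no: "\<not> ?thesis"
      then have "separates K1 y"
        using y(2) face_in[OF y(1)] face_in[OF alpha_D[OF y(1)]] unfolding separates_def by simp
      then show False using K1_dl[OF y(1)] K1(3)[OF y(1)] no by blast
    qed
    ultimately have "side R0 (fst x) ?a ?K"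
      using face_in[OF x] True by (intro sideI[where T = "?K \<inter> B"]) (simp_all, blast)
    then show ?thesis by blast
  qed
qed

text \<open>Edges leaving \<open>K\<close> lead to \<open>a\<close>, and edges leaving
  \<open>K'\<close> lead to \<open>a'\<close>. By connectedness of the dual graph, a set that no
  edge leaves is empty or everything; the common excluded region \<open>R0\<close> keeps the two
  sides from covering everything together.\<close>

lemma side_psubset:
  assumes R0: "R0 \<in> faces" and s: "side R0 c a K" and s': "side R0 c' a' K'" and a: "a \<in> K'"
  shows "K \<subset> K'"
proof -
  note F = sideD(1-4)[OF s] sideD(1-4)[OF s']
  have a': "a' \<notin> K"
  proof
    assume a': "a' \<in> K"
    \<comment> \<open>If \<open>a'\<close> were in \<open>K\<close>, no edge would leave
      \<open>K \<union> K'\<close>, although \<open>R0\<close> lies outside.\<close>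
    have "R0 \<notin> K \<union> K' \<longleftrightarrow> a' \<notin> K \<union> K'"
    proof (rule const_of_face_inv[OF _ R0 F(6)])
      fix y assume y: "y \<in> D"
      show "face y \<notin> K \<union> K' \<longleftrightarrow> face (alpha y) \<notin> K \<union> K'"
        using sideD(5)[OF s y] sideD(5)[OF s' y] a a' F(3,7) by auto
    qed
    then show False using a' F by blast
  qed
  \<comment> \<open>An edge leaving \<open>K - K'\<close> would end in \<open>K'\<close>, so its
    start would be \<open>a'\<close>, which is not in \<open>K\<close>.\<close>
  have "R \<in> K - K' \<longleftrightarrow> a \<in> K - K'" if "R \<in> faces" for R
  proof (rule const_of_face_inv[OF _ that F(2)])
    fix y assume y: "y \<in> D"
    show "face y \<in> K - K' \<longleftrightarrow> face (alpha y) \<in> K - K'"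
      using sideD(5)[OF s y] sideD(5)[OF s' y] a a' F(3,7) by auto
  qed
  then show ?thesis using F a by blast
qed

section \<open>From corner sums to region crossing changes\<close>

text \<open>The set of crossings changed by region crossing changes about \<open>S\<close>.\<close>
definition changed :: "('c \<times> nat) set set \<Rightarrow> 'c set" where
  "changed S = {c \<in> C. odd (card {R \<in> S. touches c R})}"

lemma changed_subset: "changed S \<subseteq> C" by (auto simp: changed_def)

lemma changed_sym_diff:
  assumes "S \<subseteq> faces" "T \<subseteq> faces"
  shows "changed (sym_diff S T) = sym_diff (changed S) (changed T)"
proof -
  have fin: "finite S" "finite T" using assms fin_faces finite_subset by blast+
  have "{R \<in> sym_diff S T. touches c R} =
    sym_diff {R \<in> S. touches c R} {R \<in> T. touches c R}" for c by blast
  then have "odd (card {R \<in> sym_diff S T. touches c R}) \<longleftrightarrow>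
    odd (card {R \<in> S. touches c R}) \<noteq> odd (card {R \<in> T. touches c R})" for c
    using odd_card_sym_diff[of "{R \<in> S. touches c R}" "{R \<in> T. touches c R}"] fin by simp
  then show ?thesis unfolding changed_def by blast
qed

definition changeable :: "'c set set" where "changeable = changed ` Pow faces"

lemma changeable_sym_diff: "X \<in> changeable \<Longrightarrow> Y \<in> changeable \<Longrightarrow> sym_diff X Y \<in> changeable"
proof -
  assume "X \<in> changeable" "Y \<in> changeable"
  then obtain S T where "S \<subseteq> faces" "T \<subseteq> faces" "X = changed S" "Y = changed T"
    by (auto simp: changeable_def)
  then have "sym_diff X Y = changed (sym_diff S T)" "sym_diff S T \<in> Pow faces"
    using changed_sym_diff by auto
  then show ?thesis unfolding changeable_def by blast
qed

lemma changeable_of_singletons: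
  assumes "finite Y" "\<And>c. c \<in> Y \<Longrightarrow> {c} \<in> changeable"
  shows "Y \<in> changeable"
  using assms
proof (induction Y)
  case empty
  have "changed {} = {}" by (simp add: changed_def)
  then show ?case unfolding changeable_def by blast
next
  case (insert c Y)
  then have "sym_diff {c} Y \<in> changeable" by (intro changeable_sym_diff) auto
  moreover have "sym_diff {c} Y = insert c Y" using insert by blast
  ultimately show ?case by simp
qed

text \<open>Opposite corners suffice, as adjacent corners have different checkerboard
  colours.\<close>

definition nugatory :: "'c \<Rightarrow> ('c \<times> nat) set \<Rightarrow> bool" where
  "nugatory c a \<longleftrightarrow> (\<exists>x\<in>D. fst x = c \<and> face x = a \<and> face (rot (rot x)) = a)"

lemma nugatoryI: "x \<in> D \<Longrightarrow> face (rot (rot x)) = face x \<Longrightarrow> nugatory (fst x) (face x)"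
  unfolding nugatory_def by blast

lemma nugatory_side: "nugatory c a \<Longrightarrow> \<exists>K. side R0 c a K"
  unfolding nugatory_def using side_exists by blast

lemma touched_set:
  assumes x: "x \<in> D" and S: "S \<subseteq> faces"
  shows "{R \<in> S. touches (fst x) R} =
    S \<inter> {face x, face (rot x), face (rot (rot x)), face (rot (rot (rot x)))}" (is "_ = S \<inter> ?F")
proof -
  have "touches (fst x) R \<longleftrightarrow> R \<in> ?F" if R: "R \<in> faces" for R
  proof
    assume "touches (fst x) R"
    then obtain i where i: "i < 4" "(fst x, i) \<in> R" by (auto simp: touches_def)
    then have d: "(fst x, i) \<in> D" using fst_D[OF x] by (simp add: darts_def)
    have "(fst x, i) \<in> {x, rot x, rot (rot x), rot (rot (rot x))}"
      using same_crossing_cases[OF x d] by simp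
    moreover have "face (fst x, i) = R" using face_mem_iff[OF R d] i by simp
    ultimately show "R \<in> ?F" by (metis insert_iff empty_iff)
  next
    assume "R \<in> ?F"
    then obtain y where "y \<in> {x, rot x, rot (rot x), rot (rot (rot x))}" and f: "face y = R"
      by blast
    then have y: "y \<in> D" "fst y = fst x" using x rot_D[OF x] rot_D[OF rot_D[OF x]] rot_D[OF rot_D[OF rot_D[OF x]]] by auto
    have "y \<in> R" using face_self[of y] f by simp
    then have "(fst x, snd y) \<in> R" "snd y < 4" using y by (auto simp: darts_def)
    then show "touches (fst x) R" by (auto simp: touches_def)
  qed
  then show ?thesis using S by blast
qed

text \<open>At a nugatory crossing the region \<open>a\<close> has two corners but touches only once.\<close>
lemma changed_eq_odd_corners:
  assumes S: "S \<subseteq> faces"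
  shows "changed S = sym_diff (odd_corners S) {c \<in> C. \<exists>a\<in>S. nugatory c a}"
proof -
  obtain B where B: "\<forall>x\<in>D. separates B x" using checkerboard_exists by blast
  have adj: "face (rot y) \<noteq> face y" if "y \<in> D" for y
    using B that separates_rot[OF that] by metis
  have main: "odd (card {R \<in> S. touches c R}) \<longleftrightarrow> (c \<in> odd_corners S) \<noteq> (\<exists>a\<in>S. nugatory c a)"
    if c: "c \<in> C" for c
  proof -
    have nug: ?thesis if x: "x \<in> D" "fst x = c" "face (rot (rot x)) = face x" for x
    proof -
      \<comment> \<open>The only purpose of this side is \<open>T\<close>: it omits
        \<open>face x\<close> and has odd corner sum at \<open>c\<close>, so it distinguishes the
        other two corners, and the crossing touches three different regions.\<close>
      obtain K where K: "side (face x) c (face x) K" using side_exists[OF x(1,3)] x(2) by blast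
      obtain T where T: "face x \<notin> T" "odd_corners T = {c}" using sideD(3,6)[OF K] by blast
      have "corner_parity T x" using corner_parity_iff[OF x(1)] T x by simp
      then have ne: "face (rot x) \<noteq> face (rot (rot (rot x)))" using x(3) T(1) unfolding corner_parity_def by auto
      have nugc: "nugatory c a \<longleftrightarrow> a = face x" for a
      proof
        assume "nugatory c a"
        then obtain y where y: "y \<in> D" "fst y = c" "face y = a" "face (rot (rot y)) = a"
          by (auto simp: nugatory_def)
        have "y \<in> {x, rot x, rot (rot x), rot (rot (rot x))}"
          using same_crossing_cases[OF x(1) y(1)] x y by simp
        then show "a = face x" using x(3) y ne rot4[OF x(1)] by auto
      next
        assume "a = face x"
        then show "nugatory c a" using nugatoryI[OF x(1,3)] x(2) by simp
      qed
      have "{R \<in> S. touches c R} = S \<inter> {face x, face (rot x), face (rot (rot (rot x)))}"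
        using touched_set[OF x(1) S] x by auto
      then have "odd (card {R \<in> S. touches c R}) \<longleftrightarrow>
          (face x \<in> S) \<noteq> ((face (rot x) \<in> S) \<noteq> (face (rot (rot (rot x))) \<in> S))"
        using ne adj[OF x(1)] adj[OF rot_D[OF rot_D[OF x(1)]]] x(3)
        by (auto simp: Int_insert_right card_insert_if)
      moreover have "c \<in> odd_corners S \<longleftrightarrow> corner_parity S x" using corner_parity_iff[OF x(1)] x by simp
      ultimately show ?thesis using nugc x(3) unfolding corner_parity_def by auto
    qed
    show ?thesis
    proof (cases "\<exists>a. nugatory c a")
      case True
      then show ?thesis using nug by (auto simp: nugatory_def)
    next
      case False
      let ?x = "(c, 0)"
      have x: "?x \<in> D" using base_dart c by blast
      have "face (rot (rot ?x)) \<noteq> face ?x" "face (rot (rot (rot ?x))) \<noteq> face (rot ?x)"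
        using False nugatoryI[OF x] nugatoryI[OF rot_D[OF x]] by auto
      moreover have "face (rot (rot (rot ?x))) \<noteq> face ?x"
        using adj[of "rot (rot (rot ?x))"] x rot_D rot4[OF x] by metis
      ultimately have "odd (card {R \<in> S. touches c R}) \<longleftrightarrow> corner_parity S ?x"
        using touched_set[OF x S] adj[OF x] adj[OF rot_D[OF x]] adj[OF rot_D[OF rot_D[OF x]]]
        unfolding corner_parity_def by (simp add: Int_insert_right card_insert_if)
      then show ?thesis using False c by (auto simp: odd_corners_def)
    qed
  qed
  then show ?thesis unfolding changed_def using odd_corners_subset by blast
qed

text \<open>\<open>changed T\<close> is \<open>{c}\<close> up to crossings that are nugatory for a
  region in \<open>K\<close>; their sides are strictly smaller by \<open>side_psubset\<close>.
  Keeping \<open>R0\<close> fixed throughout is what makes the sides nest.\<close>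

lemma side_changeable:
  assumes R0: "R0 \<in> faces"
  shows "side R0 c a K \<Longrightarrow> {c} \<in> changeable"
proof (induction "card K" arbitrary: c a K rule: less_induct)
  case less
  obtain T where T: "T \<subseteq> K" "odd_corners T = {c}" using sideD(6)[OF less.prems] by blast
  have K: "K \<subseteq> faces" using less.prems by (rule sideD)
  let ?Y = "{c' \<in> C. \<exists>a\<in>T. nugatory c' a}"
  have "?Y \<in> changeable"
  proof (rule changeable_of_singletons)
    fix c' assume "c' \<in> ?Y"
    then obtain a' where a': "a' \<in> T" "nugatory c' a'" by blast
    then obtain K' where K': "side R0 c' a' K'" using nugatory_side by blast
    have "K' \<subset> K" using side_psubset[OF R0 K' less.prems] a'(1) T(1) by blast
    then have "card K' < card K" using finite_subset[OF K fin_faces] by (simp add: psubset_card_mono)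
    then show "{c'} \<in> changeable" using less.hyps[OF _ K'] by simp
  qed (use finC in simp)
  moreover have "changed T \<in> changeable" using T K by (auto simp: changeable_def)
  ultimately have "sym_diff (changed T) ?Y \<in> changeable" by (rule changeable_sym_diff[rotated])
  moreover have "sym_diff (changed T) ?Y = {c}" using changed_eq_odd_corners[of T] T K by blast
  ultimately show ?case by simp
qed

lemma changed_surj:
  assumes "Y \<subseteq> C"
  shows "\<exists>S\<subseteq>faces. changed S = Y"
proof -
  obtain R0 where R0: "R0 \<in> faces" using neC base_dart face_in by blast
  have nug: "{c} \<in> changeable" if "nugatory c a" for c a
    using nugatory_side[OF that] side_changeable[OF R0] by blast
  obtain S where S: "S \<subseteq> faces" "odd_corners S = Y" using odd_corners_surj[OF assms] by blast
  let ?Z = "{c \<in> C. \<exists>a\<in>S. nugatory c a}"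
  have "?Z \<in> changeable"
  proof (rule changeable_of_singletons)
    show "{c} \<in> changeable" if "c \<in> ?Z" for c using that nug by blast
  qed (use finC in simp)
  moreover have "changed S \<in> changeable" using S by (auto simp: changeable_def)
  ultimately have "sym_diff (changed S) ?Z \<in> changeable" by (rule changeable_sym_diff[rotated])
  moreover have "sym_diff (changed S) ?Z = Y" using changed_eq_odd_corners[OF S(1)] S(2) by blast
  ultimately show ?thesis by (auto simp: changeable_def)
qed

section \<open>Freeze crossing changes and the parity functional\<close>

lemma rcc_about_changed: "rcc_about C S ov = (\<lambda>c. (c \<in> changed S) \<noteq> ov c)"
  by (auto simp: rcc_about_def changed_def)

lemma flip_eq_crossing_change: "(\<lambda>d. (d \<in> Y) \<noteq> ov d) = crossing_change c ov \<longleftrightarrow> Y = {c}"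
  unfolding crossing_change_def fun_eq_iff by auto

lemma ineffective_iff: "ineffective C alpha ov S \<longleftrightarrow> S \<subseteq> faces \<and> changed S = {}"
  unfolding ineffective_def rcc_about_changed fun_eq_iff by auto

lemma star_iff: "star_crossing C alpha ov c \<longleftrightarrow> (\<exists>S\<subseteq>faces. odd (card S) \<and> changed S = {c})"
  unfolding star_crossing_def rcc_about_changed flip_eq_crossing_change by auto

text \<open>Freezing at one region adds \<open>C\<close> to its region crossing change modulo 2;
  over \<open>S\<close> the term \<open>C\<close> survives only for odd
  \<open>card S\<close>.\<close>

definition freeze_changed :: "('c \<times> nat) set set \<Rightarrow> 'c set" where
  "freeze_changed S = (if odd (card S) then C - changed S else changed S)"

lemma freeze_changed_toggle:
  assumes "S \<subseteq> faces" "R \<in> faces"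
  shows "freeze_changed (sym_diff S {R}) = sym_diff (freeze_changed S) {c \<in> C. \<not> touches c R}"
proof -
  have fin: "finite S" using assms fin_faces finite_subset by blast
  have "{R' \<in> {R}. touches c R'} = (if touches c R then {R} else {})" for c by auto
  then have "odd (card {R' \<in> {R}. touches c R'}) \<longleftrightarrow> touches c R" for c by simp
  then have "changed {R} = {c \<in> C. touches c R}" unfolding changed_def by blast
  then have "changed (sym_diff S {R}) = sym_diff (changed S) {c \<in> C. touches c R}"
    using changed_sym_diff[of S "{R}"] assms by simp
  moreover have "odd (card (sym_diff S {R})) \<longleftrightarrow> even (card S)"
    using odd_card_sym_diff[of S "{R}"] fin by simp
  ultimately show ?thesis unfolding freeze_changed_def using changed_subset[of S] by auto
qed

text \<open>Order is irrelevant and repetitions cancel in pairs, leaving the regions that occur an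
  odd number of times.\<close>

lemma fold_freeze_exists_set:
  assumes "set rs \<subseteq> faces"
  shows "\<exists>S\<subseteq>faces. \<forall>ov. fold (freeze_cc C) rs ov = (\<lambda>c. (c \<in> freeze_changed S) \<noteq> ov c)"
  using assms
proof (induction rs)
  case Nil
  then show ?case by (intro exI[of _ "{}"]) (auto simp: freeze_changed_def changed_def)
next
  case (Cons R rs)
  then obtain S where S: "S \<subseteq> faces" "\<And>ov. fold (freeze_cc C) rs ov = (\<lambda>c. (c \<in> freeze_changed S) \<noteq> ov c)"
    by auto
  have "sym_diff S {R} \<subseteq> faces" using S Cons by auto
  moreover have "fold (freeze_cc C) (R # rs) ov = (\<lambda>c. (c \<in> freeze_changed (sym_diff S {R})) \<noteq> ov c)" for ov
    using freeze_changed_toggle[of S R] S Cons.prems by (auto simp: freeze_cc_def fun_eq_iff)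
  ultimately show ?case by blast
qed

lemma fold_freeze_of_set:
  assumes "set rs \<subseteq> faces" "distinct rs"
  shows "fold (freeze_cc C) rs ov = (\<lambda>c. (c \<in> freeze_changed (set rs)) \<noteq> ov c)"
  using assms
proof (induction rs arbitrary: ov)
  case Nil
  then show ?case by (auto simp: freeze_changed_def changed_def)
next
  case (Cons R rs)
  have "set (R # rs) = sym_diff (set rs) {R}" using Cons.prems by auto
  then have "freeze_changed (set (R # rs)) = freeze_changed (sym_diff (set rs) {R})" by (rule arg_cong)
  also have "\<dots> = sym_diff (freeze_changed (set rs)) {c \<in> C. \<not> touches c R}"
    using Cons.prems by (intro freeze_changed_toggle) auto
  finally have eq: "freeze_changed (set (R # rs)) = \<dots>" .
  have "fold (freeze_cc C) (R # rs) ov c = ((c \<in> freeze_changed (set rs)) \<noteq> freeze_cc C R ov c)" for c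
    using Cons by simp
  moreover have "freeze_cc C R ov c \<longleftrightarrow> (c \<in> C \<and> \<not> touches c R) \<noteq> ov c" for c
    by (auto simp: freeze_cc_def)
  ultimately show ?case unfolding eq fun_eq_iff by blast
qed

lemma freeze_realizable_iff: "freeze_realizable C alpha ov c \<longleftrightarrow> (\<exists>S\<subseteq>faces. freeze_changed S = {c})"
proof
  assume "freeze_realizable C alpha ov c"
  then obtain rs where rs: "set rs \<subseteq> faces" "fold (freeze_cc C) rs ov = crossing_change c ov"
    by (auto simp: freeze_realizable_def)
  obtain S where S: "S \<subseteq> faces" "fold (freeze_cc C) rs ov = (\<lambda>c. (c \<in> freeze_changed S) \<noteq> ov c)"
    using fold_freeze_exists_set[OF rs(1)] by blast
  have "freeze_changed S = {c}" using rs(2) unfolding S(2) flip_eq_crossing_change .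
  then show "\<exists>S\<subseteq>faces. freeze_changed S = {c}" using S(1) by blast
next
  assume "\<exists>S\<subseteq>faces. freeze_changed S = {c}"
  then obtain S where S: "S \<subseteq> faces" "freeze_changed S = {c}" by blast
  obtain rs where rs: "set rs = S" "distinct rs"
    using finite_distinct_list[OF finite_subset[OF S(1) fin_faces]] by blast
  have "fold (freeze_cc C) rs ov = (\<lambda>d. (d \<in> freeze_changed S) \<noteq> ov d)"
    using fold_freeze_of_set[of rs ov] rs S(1) by simp
  also have "\<dots> = crossing_change c ov" unfolding flip_eq_crossing_change by (rule S(2))
  finally show "freeze_realizable C alpha ov c"
    unfolding freeze_realizable_def using rs(1) S(1) by blast
qed

lemma freeze_iff_even_star:
  assumes ker: "\<And>S. S \<subseteq> faces \<Longrightarrow> changed S = {} \<Longrightarrow> even (card S)"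
  shows "(\<forall>c\<in>C. freeze_realizable C alpha ov c) \<longleftrightarrow>
    even (card {c \<in> C. star_crossing C alpha ov c})"
proof -
  let ?star = "star_crossing C alpha ov"
  have sd: "odd (card (sym_diff S T)) \<longleftrightarrow> odd (card S) \<noteq> odd (card T)"
    if "S \<subseteq> faces" "T \<subseteq> faces" for S T
    using that fin_faces finite_subset by (intro odd_card_sym_diff) blast+
  \<comment> \<open>Two sets realizing the same change differ by an ineffective set, which is even;
    so the parity depends on \<open>c\<close> only.\<close>
  have parity: "odd (card S) \<longleftrightarrow> ?star c" if S: "S \<subseteq> faces" "changed S = {c}" for S c
  proof
    assume "?star c"
    then obtain T where T: "T \<subseteq> faces" "odd (card T)" "changed T = {c}" by (auto simp: star_iff)
    have "even (card (sym_diff S T))" using S T changed_sym_diff[of S T] by (intro ker) auto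
    then show "odd (card S)" using sd[of S T] S T by blast
  qed (use S star_iff in blast)
  \<comment> \<open>Additivity: the parity functional of a set of crossings counts its star
    crossings modulo 2.\<close>
  have lin: "\<exists>S\<subseteq>faces. changed S = A \<and> (odd (card S) \<longleftrightarrow> odd (card {c \<in> A. ?star c}))"
    if "A \<subseteq> C" for A
  proof -
    have "finite A" using that finC finite_subset by blast
    then show ?thesis using that
    proof (induction A)
      case empty
      show ?case by (intro exI[of _ "{}"]) (auto simp: changed_def)
    next
      case (insert c A)
      then obtain S where S: "S \<subseteq> faces" "changed S = A" "odd (card S) \<longleftrightarrow> odd (card {c \<in> A. ?star c})"
        by auto
      obtain T where T: "T \<subseteq> faces" "changed T = {c}" using changed_surj[of "{c}"] insert.prems by auto
      have "changed (sym_diff S T) = insert c A" using changed_sym_diff[OF S(1) T(1)] S T insert.hyps by auto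
      moreover have "{d \<in> insert c A. ?star d} =
          (if ?star c then insert c {d \<in> A. ?star d} else {d \<in> A. ?star d})" by auto
      then have "odd (card {d \<in> insert c A. ?star d}) \<longleftrightarrow> odd (card {d \<in> A. ?star d}) \<noteq> ?star c"
        using insert.hyps by auto
      then have "odd (card (sym_diff S T)) \<longleftrightarrow> odd (card {d \<in> insert c A. ?star d})"
        using sd[OF S(1) T(1)] S parity[OF T] by blast
      moreover have "sym_diff S T \<subseteq> faces" using S T by blast
      ultimately show ?case by blast
    qed
  qed
  \<comment> \<open>\<open>U\<close> realizes the full set \<open>C\<close>; adding it turns a
    change into the complementary one and shifts the parity by the number of star crossings.\<close>
  obtain U where U: "U \<subseteq> faces" "changed U = C" "odd (card U) \<longleftrightarrow> odd (card {c \<in> C. ?star c})"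
    using lin[of C] by auto
  show ?thesis
  proof
    assume real: "\<forall>c\<in>C. freeze_realizable C alpha ov c"
    show "even (card {c \<in> C. ?star c})"
    proof (rule ccontr)
      assume odd: "odd (card {c \<in> C. ?star c})"
      \<comment> \<open>An even \<open>S\<close> already changes \<open>c\<close> alone; an odd
        \<open>S\<close> changes all but \<open>c\<close> and becomes an even set for
        \<open>c\<close> after adding the odd \<open>U\<close>. So there would be no star crossing
        at all.\<close>
      have "\<not> ?star c" if c: "c \<in> C" for c
      proof -
        have "\<exists>S\<subseteq>faces. freeze_changed S = {c}"
          using real c by (simp add: freeze_realizable_iff)
        then obtain S where S: "S \<subseteq> faces" "freeze_changed S = {c}" by blast
        show ?thesis
        proof (cases "odd (card S)")
          case True
          then have "C - changed S = {c}" using S(2) by (simp add: freeze_changed_def)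
          then have "changed S = C - {c}" using changed_subset[of S] by blast
          then have "changed (sym_diff S U) = {c}"
            unfolding changed_sym_diff[OF S(1) U(1)] U(2) using c by auto
          moreover have "sym_diff S U \<subseteq> faces" using S U by blast
          moreover have "even (card (sym_diff S U))" using sd[OF S(1) U(1)] True U(3) odd by simp
          ultimately show ?thesis using parity by blast
        next
          case False
          then have "changed S = {c}" using S(2) by (simp add: freeze_changed_def)
          then show ?thesis using False parity[OF S(1)] by blast
        qed
      qed
      then have "{c \<in> C. ?star c} = {}" by blast
      then show False using odd by (metis card.empty even_zero)
    qed
  next
    assume even: "even (card {c \<in> C. ?star c})"
    show "\<forall>c\<in>C. freeze_realizable C alpha ov c"
    proof
      fix c assume c: "c \<in> C"
      obtain S where S: "S \<subseteq> faces" "changed S = {c}" using changed_surj[of "{c}"] c by auto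
      have "\<exists>S\<subseteq>faces. freeze_changed S = {c}"
      proof (cases "odd (card S)")
        case True
        \<comment> \<open>Adding the even \<open>U\<close> keeps the parity odd, so freezing
          complements \<open>C - {c}\<close> back to \<open>{c}\<close>.\<close>
        have "changed (sym_diff S U) = C - {c}"
          unfolding changed_sym_diff[OF S(1) U(1)] U(2) S(2) using c by auto
        moreover have "odd (card (sym_diff S U))" using sd[OF S(1) U(1)] True U(3) even by simp
        ultimately have "freeze_changed (sym_diff S U) = C - (C - {c})" unfolding freeze_changed_def by simp
        then have "freeze_changed (sym_diff S U) = {c}" using c by blast
        moreover have "sym_diff S U \<subseteq> faces" using S U by blast
        ultimately show ?thesis by blast
      next
        case False
        then have "freeze_changed S = {c}" using S(2) by (simp add: freeze_changed_def)
        then show ?thesis using S(1) by blast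
      qed
      then show "freeze_realizable C alpha ov c" by (simp add: freeze_realizable_iff)
    qed
  qed
qed

end

theorem theorem3p5:
  fixes C :: "'c set" and alpha :: "'c \<times> nat \<Rightarrow> 'c \<times> nat" and ov :: "'c \<Rightarrow> bool"
  assumes "knot_projection C alpha"
    and "\<forall>S. ineffective C alpha ov S \<longrightarrow> even (card S)"
  shows "(\<forall>c\<in>C. freeze_realizable C alpha ov c) \<longleftrightarrow>
         even (card {c \<in> C. star_crossing C alpha ov c})"
proof -
  interpret knot_map C alpha using assms(1) by unfold_locales
  show ?thesis using assms(2) by (intro freeze_iff_even_star) (auto simp: ineffective_iff)
qed

end
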